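(* Let $A\in\mathbb{C}^{N\times N}$, $\mathbf b,\mathbf x_0\in\mathbb{C}^N$, $\mathbf r_0=\mathbf b-A\mathbf x_0\neq\mathbf 0$, let $\varepsilon\in[0,1)$, and let $S\in\mathbb{C}^{s\times N}$ satisfy $$(1-\varepsilon)\|\mathbf v\|^2\le\|S\mathbf v\|^2\le(1+\varepsilon)\|\mathbf v\|^2\qquad\text{for all }\mathbf v\in\mathcal K_{m+1}(A,\mathbf r_0).$$ Let the columns of $V_m\in\mathbb{C}^{N\times m}$ form a basis of $\mathcal K_m(A,\mathbf r_0)$, let $\widetilde{\mathbf x}_m=\mathbf x_0+V_m(SAV_m)^\dagger S\mathbf r_0$ be the sketched GMRES approximation, and let $\widetilde{\mathbf r}_m=\mathbf b-A\widetilde{\mathbf x}_m$ be its residual. Then, writing $\theta=\theta\left(\mathbf r_0,\,A\mathcal K_m(A,\mathbf r_0)\right)$, $$\|\widetilde{\mathbf r}_m\|\;\le\;\|\mathbf r_0\|\sqrt{\frac{\sin^2\theta+2\varepsilon(1+\cos\theta)}{1-\varepsilon^2}}\;\le\;\|\mathbf r_0\|\sqrt{\frac{\sin^2\theta+4\varepsilon}{1-\varepsilon^2}} .$$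
   Context: $\mathcal{K}_j(A,\mathbf r_0)=\mathrm{span}\{\mathbf r_0,A\mathbf r_0,\ldots,A^{j-1}\mathbf r_0\}$; $A\mathcal K_m=\{A\mathbf v:\mathbf v\in\mathcal K_m\}$. $\|\cdot\|$ is the Euclidean norm and $\dagger$ the Moore--Penrose pseudoinverse. For a nonzero vector $\mathbf v$ and a subspace $\mathcal W$ with orthogonal projector $P_{\mathcal W}$, the angle $\theta(\mathbf v,\mathcal W)\in[0,\pi/2]$ is defined by $\cos\theta(\mathbf v,\mathcal W)=\|P_{\mathcal W}\mathbf v\|/\|\mathbf v\|$, equivalently $\sin\theta(\mathbf v,\mathcal W)=\|(I-P_{\mathcal W})\mathbf v\|/\|\mathbf v\|$. *)

theory Defs
  imports "HOL-Analysis.Analysis"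
begin

(* vec.span is the span over the complex scalars (whereas span is the real one).
   The power is function iteration; ^ on square matrices would act entrywise. *)
definition krylov :: "complex^'n^'n \<Rightarrow> complex^'n \<Rightarrow> nat \<Rightarrow> (complex^'n) set" where
  "krylov A r j = vec.span ((\<lambda>i. (((*v) A) ^^ i) r) ` {..<j})"

(* The library inner product on complex^'n is only the real part of this one. *)
definition hinner :: "complex^'n \<Rightarrow> complex^'n \<Rightarrow> complex" where
  "hinner x y = (\<Sum>i\<in>UNIV. x $ i * cnj (y $ i))"

definition orth_proj :: "(complex^'n) set \<Rightarrow> complex^'n \<Rightarrow> complex^'n" where
  "orth_proj W v = (THE w. w \<in> W \<and> (\<forall>u\<in>W. hinner (v - w) u = 0))"

(* For v nonzero and W a complex subspace the quotient lies in [0,1], so this is the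
   unique angle in [0, pi/2] with the given cosine. *)
definition subspace_angle :: "complex^'n \<Rightarrow> (complex^'n) set \<Rightarrow> real" where
  "subspace_angle v W = arccos (norm (orth_proj W v) / norm v)"

definition conj_transpose :: "complex^'n^'m \<Rightarrow> complex^'m^'n" where
  "conj_transpose M = (\<chi> i j. cnj (M $ j $ i))"

(* The four Penrose equations, which determine X uniquely. *)
definition is_pseudoinverse :: "complex^'n^'m \<Rightarrow> complex^'m^'n \<Rightarrow> bool" where
  "is_pseudoinverse M X \<longleftrightarrow>
     M ** X ** M = M \<and>
     X ** M ** X = X \<and>
     conj_transpose (M ** X) = M ** X \<and>
     conj_transpose (X ** M) = X ** M"

definition pseudoinverse :: "complex^'n^'m \<Rightarrow> complex^'m^'n" where
  "pseudoinverse M = (THE X. is_pseudoinverse M X)"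

definition sketched_gmres ::
  "complex^'n^'n \<Rightarrow> complex^'n \<Rightarrow> complex^'n \<Rightarrow> complex^'n^'s \<Rightarrow> complex^'m^'n \<Rightarrow> complex^'n" where
  "sketched_gmres A b x0 S V =
     x0 + V *v (pseudoinverse (S ** A ** V) *v (S *v (b - A *v x0)))"

(* Injectivity excludes repeated columns, which the set of columns would not show. *)
definition columns_form_basis :: "complex^'m^'n \<Rightarrow> (complex^'n) set \<Rightarrow> bool" where
  "columns_form_basis V W \<longleftrightarrow>
     inj (\<lambda>j. column j V) \<and> vec.independent (columns V) \<and> vec.span (columns V) = W"

end

theory Submission
  imports Defs
begin

text \<open>
  Let \<open>n\<close> be the component of \<open>r0\<close> orthogonal to \<open>W = A K\<^sub>m\<close>, so that \<open>norm n = norm r0 * sin \<theta>\<close>, and put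
  \<open>w = n - rt \<in> W\<close>. The sketched residual \<open>S rt\<close> is orthogonal to \<open>S W\<close>. Wielandt's inequality says
  that an \<open>\<epsilon>\<close>-embedding makes \<open>\<bar>x \<bullet> y\<bar> \<le> \<epsilon> * norm x * norm y\<close> whenever \<open>S x\<close> and \<open>S y\<close> are
  orthogonal. Since \<open>n\<close> is orthogonal to \<open>w\<close>, \<open>(norm w)\<^sup>2 = - (rt \<bullet> w)\<close>, hence
  \<open>norm w \<le> \<epsilon> * norm rt\<close>, and \<open>(norm rt)\<^sup>2 = (norm n)\<^sup>2 + (norm w)\<^sup>2\<close> gives the bound
  \<open>(norm rt)\<^sup>2 \<le> (norm r0)\<^sup>2 * (sin \<theta>)\<^sup>2 / (1 - \<epsilon>\<^sup>2)\<close>, which is sharper than the one claimed.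
\<close>

section \<open>The Hermitian inner product and orthogonal projections\<close>

lemma Re_hinner: "Re (hinner x y) = x \<bullet> y"
  by (simp add: hinner_def inner_vec_def inner_complex_def)

lemma hinner_add_left: "hinner (x + y) z = hinner x z + hinner y z"
  by (simp add: hinner_def algebra_simps sum.distrib)

lemma hinner_diff_left: "hinner (x - y) z = hinner x z - hinner y z"
  by (simp add: hinner_def algebra_simps sum_subtractf)

lemma hinner_scale_left: "hinner (c *s x) z = c * hinner x z"
  by (simp add: hinner_def sum_distrib_left mult.assoc)

lemma hinner_diff_right: "hinner z (x - y) = hinner z x - hinner z y"
  by (simp add: hinner_def algebra_simps sum_subtractf)

lemma hinner_scale_right: "hinner z (c *s x) = cnj c * hinner z x"
  by (simp add: hinner_def sum_distrib_left algebra_simps)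

lemma cnj_hinner: "cnj (hinner x y) = hinner y x"
  by (simp add: hinner_def mult.commute)

lemma hinner_self_eq_0_iff: "hinner x x = 0 \<longleftrightarrow> x = 0"
proof
  assume "hinner x x = 0"
  then have "x \<bullet> x = 0"
    by (metis Re_hinner zero_complex.sel(1))
  then show "x = 0" by simp
qed (simp add: hinner_def)

lemma hinner_matrix_left: "hinner (M *v x) y = hinner x (conj_transpose M *v y)"
  unfolding hinner_def matrix_vector_mult_def conj_transpose_def
  by (simp add: sum_distrib_left sum_distrib_right) (subst sum.swap, simp add: ac_simps)

text \<open>Adjoints with respect to \<open>hinner\<close> are unique: the difference of two
  candidates, applied to \<open>y\<close>, is orthogonal to every vector and hence to
  itself.\<close>

lemma conj_transpose_eqI:
  assumes "\<And>x y. hinner (P *v x) y = hinner x (P *v y)"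
  shows "conj_transpose P = P"
proof -
  have "hinner x (conj_transpose P *v y - P *v y) = 0" for x y
    by (metis assms diff_self hinner_diff_right hinner_matrix_left)
  then have "conj_transpose P *v y = P *v y" for y
    by (metis hinner_self_eq_0_iff eq_iff_diff_eq_0)
  then show ?thesis
    by (simp add: matrix_eq)
qed

lemma conj_transpose_mult: "conj_transpose (P ** Q) = conj_transpose Q ** conj_transpose P"
  by (simp add: conj_transpose_def matrix_matrix_mult_def vec_eq_iff mult.commute)

text \<open>Lets results on real inner product spaces be applied to complex subspaces.\<close>

lemma real_subspace_of_complex:
  fixes W :: "(complex^'n) set"
  assumes "vec.subspace W"
  shows "subspace W"
proof -
  have "c *\<^sub>R x = complex_of_real c *s x" for c and x :: "complex^'n"
    unfolding vec_eq_iff vector_scaleR_component vector_smult_component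
    by (simp add: scaleR_conv_of_real)
  then show ?thesis
    using assms by (simp add: vec.subspace_def subspace_def)
qed

text \<open>The real orthogonal decomposition only makes the real part of \<open>hinner z u\<close>
  vanish. Since \<open>W\<close> is closed under multiplication by \<open>\<i>\<close>, testing
  against \<open>\<i> *s u\<close> removes the imaginary part too.\<close>

lemma orth_proj_exists:
  assumes W: "vec.subspace W"
  shows "\<exists>w\<in>W. \<forall>u\<in>W. hinner (v - w) u = 0"
proof -
  have "span W = W"
    using real_subspace_of_complex[OF W] by (simp add: span_eq_iff)
  then obtain y z where y: "y \<in> W" and z: "\<And>w. w \<in> W \<Longrightarrow> z \<bullet> w = 0" and v: "v = y + z"
    by (metis orthogonal_subspace_decomp_exists[of W v] orthogonal_def)
  have "hinner z u = 0" if u: "u \<in> W" for u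
  proof (rule complex_eqI)
    show "Re (hinner z u) = Re 0"
      using z[OF u] by (simp add: Re_hinner)
    have "\<i> *s u \<in> W"
      using W u by (simp add: vec.subspace_def)
    then have "Re (hinner z (\<i> *s u)) = 0"
      using z by (simp add: Re_hinner)
    then show "Im (hinner z u) = Im 0"
      by (simp add: hinner_scale_right)
  qed
  then show ?thesis
    using y v by (intro bexI[of _ y]) auto
qed

lemma orth_proj_unique:
  assumes W: "vec.subspace W"
    and "w \<in> W" "\<And>u. u \<in> W \<Longrightarrow> hinner (v - w) u = 0"
    and "w' \<in> W" "\<And>u. u \<in> W \<Longrightarrow> hinner (v - w') u = 0"
  shows "w = w'"
proof -
  have "w - w' \<in> W"
    using assms by (simp add: vec.subspace_diff)
  then have "hinner (v - w') (w - w') - hinner (v - w) (w - w') = 0"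
    using assms by simp
  then have "hinner (w - w') (w - w') = 0"
    by (simp flip: hinner_diff_left)
  then show ?thesis
    by (simp add: hinner_self_eq_0_iff)
qed

lemma
  assumes W: "vec.subspace W"
  shows orth_proj_in: "orth_proj W v \<in> W"
    and orth_proj_orthogonal: "\<And>u. u \<in> W \<Longrightarrow> hinner (v - orth_proj W v) u = 0"
proof -
  have "\<exists>!w. w \<in> W \<and> (\<forall>u\<in>W. hinner (v - w) u = 0)"
    using orth_proj_exists[OF W] orth_proj_unique[OF W] by metis
  from theI'[OF this]
  show "orth_proj W v \<in> W" "\<And>u. u \<in> W \<Longrightarrow> hinner (v - orth_proj W v) u = 0"
    unfolding orth_proj_def by auto
qed

lemma orth_proj_eqI:
  assumes "vec.subspace W" "w \<in> W" "\<And>u. u \<in> W \<Longrightarrow> hinner (v - w) u = 0"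
  shows "orth_proj W v = w"
  using orth_proj_unique[OF assms(1)] orth_proj_in orth_proj_orthogonal assms by metis

lemma orth_proj_linear:
  assumes W: "vec.subspace W"
  shows "Vector_Spaces.linear (*s) (*s) (orth_proj W)"
proof (unfold_locales)
  fix x y c
  show "orth_proj W (x + y) = orth_proj W x + orth_proj W y"
  proof (rule orth_proj_eqI[OF W])
    show "orth_proj W x + orth_proj W y \<in> W"
      by (simp add: W orth_proj_in vec.subspace_add)
    show "hinner (x + y - (orth_proj W x + orth_proj W y)) u = 0" if "u \<in> W" for u
      using orth_proj_orthogonal[OF W that, of x] orth_proj_orthogonal[OF W that, of y]
      by (simp add: hinner_diff_left hinner_add_left)
  qed
  show "orth_proj W (c *s x) = c *s orth_proj W x"
  proof (rule orth_proj_eqI[OF W])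
    show "c *s orth_proj W x \<in> W"
      by (simp add: W orth_proj_in vec.subspace_scale)
    show "hinner (c *s x - c *s orth_proj W x) u = 0" if "u \<in> W" for u
      using orth_proj_orthogonal[OF W that, of x]
      by (simp add: hinner_diff_left hinner_scale_left)
  qed
qed

text \<open>Supplies the Hermitian projectors from which the pseudoinverse is assembled.\<close>

lemma orth_proj_matrix:
  fixes W :: "(complex^'n) set"
  assumes W: "vec.subspace W"
  shows "\<exists>P :: complex^'n^'n. conj_transpose P = P \<and> (\<forall>x. P *v x \<in> W) \<and> (\<forall>x\<in>W. P *v x = x)"
proof (intro exI conjI allI ballI)
  let ?P = "matrix (orth_proj W)"
  have P: "?P *v x = orth_proj W x" for x
    using W by (simp add: matrix_works orth_proj_linear)
  show "?P *v x \<in> W" for x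
    by (simp add: P W orth_proj_in)
  show "?P *v x = x" if "x \<in> W" for x
    unfolding P by (rule orth_proj_eqI) (use W that in \<open>auto simp: hinner_def\<close>)
  show "conj_transpose ?P = ?P"
  proof (rule conj_transpose_eqI, unfold P)
    fix x y
    have "hinner (x - orth_proj W x) (orth_proj W y) = 0"
      using W orth_proj_in orth_proj_orthogonal by blast
    moreover have "hinner (orth_proj W x) (y - orth_proj W y) = 0"
      by (metis W cnj_hinner complex_cnj_zero orth_proj_in orth_proj_orthogonal)
    ultimately show "hinner (orth_proj W x) y = hinner x (orth_proj W y)"
      by (simp add: hinner_diff_left hinner_diff_right)
  qed
qed

section \<open>The Moore--Penrose pseudoinverse\<close>

text \<open>\<open>R\<close> is the matrix of a linear map choosing a preimage for each vector in
  the range of \<open>M\<close>.\<close>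

lemma generalized_inverse_exists:
  fixes M :: "complex^'n^'m"
  obtains R :: "complex^'m^'n" where "M ** R ** M = M"
proof -
  obtain g where g: "Vector_Spaces.linear (*s) (*s) g" "\<And>v. M *v g (M *v v) = M *v v"
    using vec.linear_exists_right_inverse_on[OF matrix_vector_mul_linear_gen[of M] vec.subspace_UNIV]
    by auto
  have "M ** matrix g ** M = M"
    by (simp add: matrix_eq g matrix_works flip: matrix_vector_mul_assoc)
  then show ?thesis ..
qed

text \<open>If \<open>P\<close> and \<open>Q\<close> project orthogonally onto the range of \<open>M\<close> and onto the complement of its kernel,
  and \<open>R\<close> is any generalized inverse of \<open>M\<close>, then \<open>Q R P\<close> satisfies the Penrose equations.\<close>

lemma pseudoinverse_exists:
  fixes M :: "complex^'n^'m"
  shows "\<exists>X. is_pseudoinverse M X"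
proof -
  have "vec.subspace (range ((*v) M))"
    by (intro vec.linear_subspace_image matrix_vector_mul_linear_gen vec.subspace_UNIV)
  from orth_proj_matrix[OF this]
  obtain P where P: "conj_transpose P = P" "\<forall>x. P *v x \<in> range ((*v) M)"
    "\<forall>x\<in>range ((*v) M). P *v x = x"
    by blast
  have "vec.subspace {x. M *v x = 0}"
    by (simp add: vec.subspace_def matrix_vector_right_distrib vec.scale)
  from orth_proj_matrix[OF this]
  obtain L where L: "conj_transpose L = L" "\<And>x. M *v (L *v x) = 0"
    "\<And>x. M *v x = 0 \<Longrightarrow> L *v x = x"
    by auto
  \<comment> \<open>\<open>L\<close> projects onto the kernel of \<open>M\<close>, so
    \<open>Q\<close> projects onto its orthogonal complement.\<close>
  define Q where "Q = mat 1 - L"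
  have Qv: "Q *v x = x - L *v x" for x
    by (simp add: Q_def matrix_vector_mult_diff_rdistrib)
  obtain R where R: "M ** R ** M = M"
    using generalized_inverse_exists by blast
  have Rv: "M *v (R *v (M *v x)) = M *v x" for x
    using R by (simp add: matrix_vector_mul_assoc matrix_mul_assoc)
  have MQ: "M *v (Q *v x) = M *v x" for x
    by (simp add: Qv L matrix_vector_mult_diff_distrib)
  have MRP: "M *v (R *v (P *v x)) = P *v x" for x
    using P(2)[rule_format, of x] by (auto simp: Rv)
  have PM: "P *v (M *v x) = M *v x" for x
    by (simp add: P)
  \<comment> \<open>\<open>R *v (M *v x)\<close> and \<open>x\<close> have the same image under
    \<open>M\<close>, so they differ by a kernel vector, which \<open>L\<close> fixes and
    \<open>Q\<close> annihilates.\<close>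
  have QRM: "Q *v (R *v (M *v x)) = Q *v x" for x
  proof -
    have "L *v (R *v (M *v x) - x) = R *v (M *v x) - x"
      by (rule L(3)) (simp add: Rv matrix_vector_mult_diff_distrib)
    then show ?thesis
      by (simp add: Qv matrix_vector_mult_diff_distrib algebra_simps)
  qed
  have QQ: "Q *v (Q *v x) = Q *v x" for x
    by (simp add: Qv L matrix_vector_mult_diff_distrib)
  have hQ: "conj_transpose Q = Q"
  proof (rule conj_transpose_eqI)
    fix x y
    show "hinner (Q *v x) y = hinner x (Q *v y)"
      using hinner_matrix_left[of L x y] by (simp add: Qv L hinner_diff_left hinner_diff_right)
  qed
  have MX: "M ** (Q ** R ** P) = P"
    by (simp add: matrix_eq MQ MRP flip: matrix_vector_mul_assoc)
  have XM: "(Q ** R ** P) ** M = Q"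
    by (simp add: matrix_eq PM QRM flip: matrix_vector_mul_assoc)
  have "is_pseudoinverse M (Q ** R ** P)"
    unfolding is_pseudoinverse_def MX XM
    by (auto simp: matrix_eq PM QQ hQ P(1) simp flip: matrix_vector_mul_assoc)
  then show ?thesis ..
qed

text \<open>\<open>M ** X\<close> and \<open>M ** Y\<close> are Hermitian and each absorbs the
  other, so taking adjoints of their product shows that they agree; likewise \<open>X ** M\<close>
  and \<open>Y ** M\<close>. Then X = XMX = XMY = YMY = Y.\<close>

lemma pseudoinverse_unique:
  assumes X: "is_pseudoinverse M X" and Y: "is_pseudoinverse M Y"
  shows "X = Y"
proof -
  have eqs: "M ** X ** M = M" "X ** M ** X = X" "conj_transpose (M ** X) = M ** X"
    "conj_transpose (X ** M) = X ** M" "M ** Y ** M = M" "Y ** M ** Y = Y"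
    "conj_transpose (M ** Y) = M ** Y" "conj_transpose (Y ** M) = Y ** M"
    using X Y by (auto simp: is_pseudoinverse_def)
  have "(M ** X) ** (M ** Y) = M ** Y"
    using eqs(1) by (simp add: matrix_mul_assoc)
  moreover have "(M ** Y) ** (M ** X) = M ** X"
    using eqs(5) by (simp add: matrix_mul_assoc)
  ultimately have MX: "M ** X = M ** Y"
    by (metis conj_transpose_mult eqs(3,7))
  have "(X ** M) ** (Y ** M) = X ** M"
    using eqs(5) by (metis matrix_mul_assoc)
  moreover have "(Y ** M) ** (X ** M) = Y ** M"
    using eqs(1) by (metis matrix_mul_assoc)
  ultimately have XM: "X ** M = Y ** M"
    by (metis conj_transpose_mult eqs(4,8))
  show ?thesis
    by (metis MX XM eqs(2,6) matrix_mul_assoc)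
qed

lemma is_pseudoinverse_pseudoinverse: "is_pseudoinverse M (pseudoinverse M)"
  unfolding pseudoinverse_def
  by (rule theI') (metis pseudoinverse_exists pseudoinverse_unique)

text \<open>These are the normal equations of least squares: \<open>M ** pseudoinverse M\<close> is
  Hermitian and fixes the range of \<open>M\<close>.\<close>

lemma pseudoinverse_residual_orthogonal:
  "(s - M *v (pseudoinverse M *v s)) \<bullet> (M *v u) = 0"
proof -
  let ?X = "pseudoinverse M"
  have MXM: "M ** ?X ** M = M" and sym: "conj_transpose (M ** ?X) = M ** ?X"
    using is_pseudoinverse_pseudoinverse[of M] by (auto simp: is_pseudoinverse_def)
  have "hinner (M *v (?X *v s)) (M *v u) = hinner s ((M ** ?X) *v (M *v u))"
    using hinner_matrix_left[of "M ** ?X" s "M *v u"] by (simp add: sym matrix_vector_mul_assoc)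
  also have "\<dots> = hinner s (M *v u)"
    by (simp add: MXM matrix_vector_mul_assoc matrix_mul_assoc)
  finally show ?thesis
    by (simp add: hinner_diff_left flip: Re_hinner)
qed

section \<open>Subspace embeddings\<close>

text \<open>For normalized vectors \<open>a\<close> and \<open>c\<close> with orthogonal images,
  \<open>a + c\<close> and \<open>a - c\<close> have images of equal norm. The lower embedding bound
  for the sum and the upper one for the difference then limit \<open>a \<bullet> c\<close>.\<close>

lemma Wielandt_embedding:
  fixes x y :: "'a::real_inner" and T :: "'a \<Rightarrow> 'b::real_inner"
  assumes T: "linear T" and W: "subspace W" and x: "x \<in> W" and y: "y \<in> W"
    and emb: "\<And>v. v \<in> W \<Longrightarrow> (1 - \<epsilon>) * (norm v)\<^sup>2 \<le> (norm (T v))\<^sup>2 \<and>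
                (norm (T v))\<^sup>2 \<le> (1 + \<epsilon>) * (norm v)\<^sup>2"
    and orth: "T x \<bullet> T y = 0"
  shows "x \<bullet> y \<le> \<epsilon> * (norm x * norm y)"
proof (cases "x = 0 \<or> y = 0")
  case False
  define a where "a = x /\<^sub>R norm x"
  define c where "c = y /\<^sub>R norm y"
  have norms: "a \<bullet> a = 1" "c \<bullet> c = 1"
    using False by (auto simp: a_def c_def dot_square_norm power2_eq_square field_simps)
  have mem: "a + c \<in> W" "a - c \<in> W"
    using W x y by (auto simp: a_def c_def intro!: subspace_add subspace_diff subspace_scale)
  have "T a \<bullet> T c = 0"
    using orth by (simp add: a_def c_def linear_scale[OF T])
  then have eq: "(norm (T (a + c)))\<^sup>2 = (norm (T (a - c)))\<^sup>2"
    by (simp add: linear_add[OF T] linear_diff[OF T] power2_norm_eq_inner inner_simps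
        inner_commute)
  have "(norm (a + c))\<^sup>2 = 2 + 2 * (a \<bullet> c)" "(norm (a - c))\<^sup>2 = 2 - 2 * (a \<bullet> c)"
    by (simp_all add: power2_norm_eq_inner inner_simps inner_commute norms)
  then have "(1 - \<epsilon>) * (2 + 2 * (a \<bullet> c)) \<le> (1 + \<epsilon>) * (2 - 2 * (a \<bullet> c))"
    using emb[OF mem(1)] emb[OF mem(2)] eq by auto
  then have "a \<bullet> c \<le> \<epsilon>"
    by (simp add: algebra_simps)
  then show ?thesis
    using False by (simp add: a_def c_def field_simps)
qed auto

lemma quasi_optimal_residual:
  fixes r n :: "'a::real_inner" and T :: "'a \<Rightarrow> 'b::real_inner"
  assumes T: "linear T" and W: "subspace W" and r: "r \<in> W" and d: "n - r \<in> W"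
    and emb: "\<And>v. v \<in> W \<Longrightarrow> (1 - \<epsilon>) * (norm v)\<^sup>2 \<le> (norm (T v))\<^sup>2 \<and>
                (norm (T v))\<^sup>2 \<le> (1 + \<epsilon>) * (norm v)\<^sup>2"
    and orth: "T r \<bullet> T (n - r) = 0" and n: "n \<bullet> (n - r) = 0"
  shows "(1 - \<epsilon>\<^sup>2) * (norm r)\<^sup>2 \<le> (norm n)\<^sup>2"
proof -
  define w where "w = n - r"
  have "n \<bullet> w = 0"
    using n by (simp add: w_def)
  then have rw: "r \<bullet> w = - (norm w)\<^sup>2"
    by (simp add: w_def power2_norm_eq_inner inner_simps)
  \<comment> \<open>The sign is flipped because \<open>r \<bullet> w\<close> is nonpositive and the
    Wielandt bound is one-sided.\<close>
  have "- r \<bullet> w \<le> \<epsilon> * (norm (- r) * norm w)"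
  proof (rule Wielandt_embedding[OF T W _ _ emb])
    show "- r \<in> W" "w \<in> W"
      using W r d by (auto simp: w_def subspace_neg)
    show "T (- r) \<bullet> T w = 0"
      using orth by (simp add: w_def linear_neg[OF T])
  qed
  then have "norm w * norm w \<le> (\<epsilon> * norm r) * norm w"
    by (simp add: rw power2_eq_square mult.assoc)
  then have "(norm w)\<^sup>2 \<le> (\<epsilon> * norm r)\<^sup>2"
    by (cases "w = 0") (auto intro: power_mono)
  moreover have "r = n - w"
    by (simp add: w_def)
  then have "(norm r)\<^sup>2 = (norm n)\<^sup>2 + (norm w)\<^sup>2"
    using \<open>n \<bullet> w = 0\<close> by (simp add: power2_norm_eq_inner inner_simps inner_commute)
  ultimately show ?thesis
    by (simp add: power_mult_distrib algebra_simps)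
qed

section \<open>The angle between a vector and a subspace\<close>

lemma orth_proj_Pythagoras:
  assumes "vec.subspace W"
  shows "(norm v)\<^sup>2 = (norm (orth_proj W v))\<^sup>2 + (norm (v - orth_proj W v))\<^sup>2"
proof -
  have "(v - orth_proj W v) \<bullet> orth_proj W v = 0"
    using orth_proj_orthogonal[OF assms orth_proj_in[OF assms]] by (simp flip: Re_hinner)
  then show ?thesis
    by (simp add: power2_norm_eq_inner inner_simps inner_commute)
qed

lemma
  assumes W: "vec.subspace W" and v: "v \<noteq> 0"
  shows cos_subspace_angle_bounds: "cos (subspace_angle v W) \<in> {0..1}"
    and sin_subspace_angle:
      "(norm v)\<^sup>2 * (sin (subspace_angle v W))\<^sup>2 = (norm (v - orth_proj W v))\<^sup>2"
proof -
  have "(norm (orth_proj W v))\<^sup>2 \<le> (norm v)\<^sup>2"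
    using orth_proj_Pythagoras[OF W, of v] by simp
  then have "norm (orth_proj W v) \<le> norm v"
    by (rule power2_le_imp_le) simp
  then have b: "norm (orth_proj W v) / norm v \<in> {0..1}"
    using v by (simp add: divide_simps)
  \<comment> \<open>The quotient lies in [0,1], within the domain where \<open>cos\<close> undoes
    \<open>arccos\<close>.\<close>
  then have c: "cos (subspace_angle v W) = norm (orth_proj W v) / norm v"
    unfolding subspace_angle_def by (intro cos_arccos) (auto intro: order_trans[of _ 0])
  then show "cos (subspace_angle v W) \<in> {0..1}"
    using b by simp
  show "(norm v)\<^sup>2 * (sin (subspace_angle v W))\<^sup>2 = (norm (v - orth_proj W v))\<^sup>2"
    using orth_proj_Pythagoras[OF W, of v] v
    by (simp add: sin_squared_eq c power_divide field_simps)
qed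

section \<open>Krylov spaces and the sketched residual\<close>

text \<open>\<open>A\<close> shifts the generator with exponent \<open>i\<close> to the one with
  exponent \<open>Suc i\<close>; \<open>r\<close> itself has exponent 0.\<close>

lemma
  shows krylov_start: "r \<in> krylov A r (Suc j)"
    and krylov_image: "((*v) A) ` krylov A r j \<subseteq> krylov A r (Suc j)"
proof -
  show "r \<in> krylov A r (Suc j)"
    unfolding krylov_def by (rule vec.span_base) (auto intro!: image_eqI[of _ _ 0])
  have "((*v) A) ` (\<lambda>i. (((*v) A) ^^ i) r) ` {..<j} \<subseteq> (\<lambda>i. (((*v) A) ^^ i) r) ` {..<Suc j}"
    by (auto intro!: image_eqI[of _ _ "Suc _"])
  then show "((*v) A) ` krylov A r j \<subseteq> krylov A r (Suc j)"
    unfolding krylov_def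
    by (metis vec.linear_span_image[OF matrix_vector_mul_linear_gen] vec.span_mono)
qed

lemma span_columns_eq_range:
  fixes V :: "'a::field^'m^'n"
  shows "vec.span (columns V) = range ((*v) V)"
proof
  have "vec.subspace (range ((*v) V))"
    by (intro vec.linear_subspace_image matrix_vector_mul_linear_gen vec.subspace_UNIV)
  moreover have "columns V \<subseteq> range ((*v) V)"
  proof -
    \<comment> \<open>Unit vectors pick out the columns, so the range contains all generators of the
      span.\<close>
    have "V *v axis j 1 = column j V" for j
      by (simp add: vec_eq_iff matrix_vector_mult_def column_def axis_def if_distrib cong: if_cong)
    then have "column j V \<in> range ((*v) V)" for j
      by (metis rangeI)
    then show ?thesis
      by (auto simp: columns_def)
  qed
  ultimately show "vec.span (columns V) \<subseteq> range ((*v) V)"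
    by (rule vec.span_minimal[rotated])
qed (use matrix_vector_mult_in_columnspace_gen in blast)

theorem corollary4p4:
  fixes A :: "complex^'N^'N"
    and b x0 r0 xt rt :: "complex^'N"
    and S :: "complex^'N^'s"
    and V :: "complex^'m^'N"
    and \<epsilon> \<theta> :: real
  assumes "r0 = b - A *v x0" and "r0 \<noteq> 0"
    and "0 \<le> \<epsilon>" and "\<epsilon> < 1"
    and "\<forall>v \<in> krylov A r0 (CARD('m) + 1).
           (1 - \<epsilon>) * (norm v)\<^sup>2 \<le> (norm (S *v v))\<^sup>2 \<and>
           (norm (S *v v))\<^sup>2 \<le> (1 + \<epsilon>) * (norm v)\<^sup>2"
    and "columns_form_basis V (krylov A r0 CARD('m))"
    and "xt = sketched_gmres A b x0 S V"
    and "rt = b - A *v xt"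
    and "\<theta> = subspace_angle r0 (((*v) A) ` krylov A r0 CARD('m))"
  shows "norm rt \<le> norm r0 * sqrt (((sin \<theta>)\<^sup>2 + 2 * \<epsilon> * (1 + cos \<theta>)) / (1 - \<epsilon>\<^sup>2)) \<and>
         norm r0 * sqrt (((sin \<theta>)\<^sup>2 + 2 * \<epsilon> * (1 + cos \<theta>)) / (1 - \<epsilon>\<^sup>2))
           \<le> norm r0 * sqrt (((sin \<theta>)\<^sup>2 + 4 * \<epsilon>) / (1 - \<epsilon>\<^sup>2))"
proof -
  define K where "K = krylov A r0 (Suc CARD('m))"
  define W where "W = ((*v) A) ` krylov A r0 CARD('m)"
  define y where "y = pseudoinverse (S ** A ** V) *v (S *v r0)"
  define n where "n = r0 - orth_proj W r0"
  have W: "vec.subspace W"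
    unfolding W_def krylov_def
    by (intro vec.linear_subspace_image matrix_vector_mul_linear_gen vec.subspace_span)
  have K: "vec.subspace K"
    by (simp add: K_def krylov_def)
  \<comment> \<open>The embedding is assumed one Krylov dimension higher so that it covers both
    \<open>r0\<close> and \<open>W\<close>, hence also \<open>rt\<close> and
    \<open>n - rt\<close>.\<close>
  have WK: "W \<subseteq> K" and r0K: "r0 \<in> K"
    by (simp_all add: W_def K_def krylov_image krylov_start)
  have W_eq: "W = range (\<lambda>u. A *v (V *v u))"
    using assms(6)
    by (simp add: W_def columns_form_basis_def span_columns_eq_range flip: image_image)
  have rt: "rt = r0 - A *v (V *v y)"
    by (simp add: assms(1,7,8) y_def sketched_gmres_def matrix_vector_right_distrib)
  then have "r0 - rt \<in> W"
    by (auto simp: W_eq)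
  then have d: "n - rt \<in> W"
    using vec.subspace_diff[OF W _ orth_proj_in[OF W, of r0], of "r0 - rt"]
    by (simp add: n_def algebra_simps)
  have "rt \<in> K"
    using vec.subspace_diff[OF K r0K, of "r0 - rt"] \<open>r0 - rt \<in> W\<close> WK by auto
  \<comment> \<open>\<open>S *v rt\<close> is the least-squares residual of
    \<open>S ** A ** V\<close> with right-hand side \<open>S *v r0\<close>, and \<open>S\<close>
    maps \<open>W\<close> onto the range of that matrix.\<close>
  have Srt: "(S *v rt) \<bullet> (S *v w) = 0" if "w \<in> W" for w
    using that pseudoinverse_residual_orthogonal[of "S *v r0" "S ** A ** V"]
    by (auto simp: W_eq rt y_def matrix_vector_mult_diff_distrib simp flip: matrix_vector_mul_assoc)
  have "(1 - \<epsilon>\<^sup>2) * (norm rt)\<^sup>2 \<le> (norm n)\<^sup>2"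
  proof (rule quasi_optimal_residual[OF _ real_subspace_of_complex[OF K]])
    show "n \<bullet> (n - rt) = 0"
      using orth_proj_orthogonal[OF W d] by (simp add: n_def flip: Re_hinner)
  qed (use \<open>rt \<in> K\<close> d WK Srt assms(5) in \<open>auto simp: K_def\<close>)
  also have "\<dots> = (norm r0)\<^sup>2 * (sin \<theta>)\<^sup>2"
    using sin_subspace_angle[OF W \<open>r0 \<noteq> 0\<close>] by (simp add: assms(9) n_def W_def)
  finally have main: "(1 - \<epsilon>\<^sup>2) * (norm rt)\<^sup>2 \<le> (norm r0)\<^sup>2 * (sin \<theta>)\<^sup>2" .
  have cos: "0 \<le> cos \<theta>" "cos \<theta> \<le> 1"
    using cos_subspace_angle_bounds[OF W \<open>r0 \<noteq> 0\<close>] by (auto simp: assms(9) W_def)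
  have pos: "0 < 1 - \<epsilon>\<^sup>2"
    using assms(3,4) by (simp add: power_less_one_iff abs_square_less_1)
  \<comment> \<open>The sharper bound with numerator \<open>(sin \<theta>)\<^sup>2\<close> is
    relaxed by adding a nonnegative term.\<close>
  have le1: "(sin \<theta>)\<^sup>2 \<le> (sin \<theta>)\<^sup>2 + 2 * \<epsilon> * (1 + cos \<theta>)"
    using assms(3) cos by simp
  have "2 * \<epsilon> * (1 + cos \<theta>) \<le> 2 * \<epsilon> * 2"
    using assms(3) cos by (intro mult_left_mono) auto
  then have le2: "(sin \<theta>)\<^sup>2 + 2 * \<epsilon> * (1 + cos \<theta>) \<le> (sin \<theta>)\<^sup>2 + 4 * \<epsilon>"
    by simp
  have "(norm rt)\<^sup>2 \<le> (norm r0)\<^sup>2 * ((sin \<theta>)\<^sup>2 / (1 - \<epsilon>\<^sup>2))"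
    using main pos by (simp add: field_simps)
  then have "norm rt \<le> sqrt ((norm r0)\<^sup>2 * ((sin \<theta>)\<^sup>2 / (1 - \<epsilon>\<^sup>2)))"
    by (rule real_le_rsqrt)
  also have "\<dots> = norm r0 * sqrt ((sin \<theta>)\<^sup>2 / (1 - \<epsilon>\<^sup>2))"
    by (subst real_sqrt_mult) simp
  also have "\<dots> \<le> norm r0 * sqrt (((sin \<theta>)\<^sup>2 + 2 * \<epsilon> * (1 + cos \<theta>)) / (1 - \<epsilon>\<^sup>2))"
    using le1 pos by (intro mult_left_mono real_sqrt_le_mono divide_right_mono) auto
  finally show ?thesis
    using le2 pos by (auto intro!: mult_left_mono real_sqrt_le_mono divide_right_mono)
qed

end
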